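(* Let $\Sigma$ be a finite alphabet and let $d_G$ be either the Besicovitch pseudometric $d_B$ or the Weyl pseudometric $d_W$ on $\Sigma^{\mathbb{Z}}$. If $f:\Sigma^{\mathbb{Z}}\to\Sigma^{\mathbb{Z}}$ is a cellular automaton that is an isometry, i.e. $d_G(f(x),f(y))= d_G(x,y)$ for all $x,y\in\Sigma^{\mathbb{Z}}$, then $f$ is a composition of a shift and a symbol permutation: there are $n\in\mathbb{Z}$ and a bijection $g:\Sigma\to\Sigma$ such that $f(x)_i=g(x_{i+n})$ for all $x\in\Sigma^{\mathbb{Z}}$, $i\in\mathbb{Z}$.
   Context: For words $u,v$ of equal length, $H(u,v)$ is the Hamming distance. On $\Sigma^{\mathbb{Z}}$, $d_B(x,y)=\limsup_{n\to\infty}\frac{H(x_{[-n,n]},y_{[-n,n]})}{2n+1}$ and $d_W(x,y)=\limsup_{n\to\infty}\max_{m\in\mathbb{Z}}\frac{H(x_{[m-n,m+n]},y_{[m-n,m+n]})}{2n+1}$. A cellular automaton on $\Sigma^{\mathbb{Z}}$ is a map that is continuous in the product topology and commutes with the shift $\sigma(x)_i=x_{i+1}$. *)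

theory Defs
  imports "HOL-Analysis.Analysis"
begin

type_synonym 'a config = "int \<Rightarrow> 'a"

(* Meaningful only for words of equal length. *)
definition hamming :: "'a list \<Rightarrow> 'a list \<Rightarrow> nat" where
  "hamming u v = card {i. i < length u \<and> u ! i \<noteq> v ! i}"

(* The word x_a x_(a+1) ... x_b, both end points included. *)
definition factor :: "'a config \<Rightarrow> int \<Rightarrow> int \<Rightarrow> 'a list" where
  "factor x a b = map x [a..b]"

(* The upper limits are taken in ereal, a complete lattice; the values lie in [0,1]. *)
definition besicovitch :: "'a config \<Rightarrow> 'a config \<Rightarrow> ereal" where
  "besicovitch x y =
     limsup (\<lambda>n. ereal (real (hamming (factor x (- int n) (int n)) (factor y (- int n) (int n)))
                        / real (2 * n + 1)))"

(* The maximum is over a finite set of values, see finite_window_densities. *)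
definition weyl :: "'a config \<Rightarrow> 'a config \<Rightarrow> ereal" where
  "weyl x y =
     limsup (\<lambda>n. ereal (Max (range (\<lambda>m::int.
       real (hamming (factor x (m - int n) (m + int n)) (factor y (m - int n) (m + int n)))
         / real (2 * n + 1)))))"

lemma hamming_le_length: "hamming u v \<le> length u"
proof -
  have "card {i. i < length u \<and> u ! i \<noteq> v ! i} \<le> card {..<length u}"
    by (intro card_mono) auto
  then show ?thesis by (simp add: hamming_def)
qed

lemma finite_window_densities:
  "finite (range (\<lambda>m::int.
     real (hamming (factor x (m - int n) (m + int n)) (factor y (m - int n) (m + int n)))
       / real (2 * n + 1)))"
proof (rule finite_subset)
  show "range (\<lambda>m::int.
      real (hamming (factor x (m - int n) (m + int n)) (factor y (m - int n) (m + int n)))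
        / real (2 * n + 1)) \<subseteq> (\<lambda>k. real k / real (2 * n + 1)) ` {..2 * n + 1}"
  proof clarify
    fix m :: int
    have "length (factor x (m - int n) (m + int n)) = 2 * n + 1"
      by (simp add: factor_def)
    then have "hamming (factor x (m - int n) (m + int n)) (factor y (m - int n) (m + int n))
        \<le> 2 * n + 1"
      using hamming_le_length by metis
    then show "real (hamming (factor x (m - int n) (m + int n)) (factor y (m - int n) (m + int n)))
        / real (2 * n + 1) \<in> (\<lambda>k. real k / real (2 * n + 1)) ` {..2 * n + 1}"
      by blast
  qed
qed simp

definition shift :: "'a config \<Rightarrow> 'a config" where
  "shift x = (\<lambda>i. x (i + 1))"

definition config_topology :: "'a config topology" where
  "config_topology = product_topology (\<lambda>_. discrete_topology UNIV) UNIV"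

definition cellular_automaton :: "('a config \<Rightarrow> 'a config) \<Rightarrow> bool" where
  "cellular_automaton f \<longleftrightarrow>
     continuous_map config_topology config_topology f \<and> (\<forall>x. f (shift x) = shift (f x))"

end

theory Submission
  imports Defs "HOL-Real_Asymp.Real_Asymp"
begin

text \<open>On configurations of a common period both pseudometrics equal the density of differences in one
  period. Repeating a finite pattern of differences periodically therefore shows that \<open>f\<close> preserves the
  number of differences between any two configurations that differ in finitely many cells. In particular,
  changing cell \<open>i\<close> of \<open>x\<close> changes the image in exactly one cell, and comparing the four configurations
  obtained from changes in two cells \<open>i\<close> and \<open>j\<close> shows that this cell is unaffected by a change of \<open>x\<close>
  in \<open>j\<close>. Starting from a constant configuration, the cell is \<open>i + k\<close> for a fixed \<open>k\<close>; by locality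
  \<open>f x (i + k)\<close> then depends on \<open>x i\<close> only.\<close>

section \<open>Difference sets and Hamming distance\<close>

definition diff_set :: "'a config \<Rightarrow> 'a config \<Rightarrow> int set" where
  "diff_set x y = {i. x i \<noteq> y i}"

lemma diff_set_singletonD: "diff_set x y = {k} \<Longrightarrow> x i = y i \<longleftrightarrow> i \<noteq> k"
  unfolding diff_set_def by blast

text \<open>Word positions become cells through the offset \<open>a\<close>; from here on distances
  are handled as counts of difference sets in windows.\<close>

lemma hamming_factor:
  "hamming (factor x a b) (factor y a b) = card (diff_set x y \<inter> {a..b})"
proof -
  have "bij_betw (\<lambda>i. a + int i)
      {i. i < length (factor x a b) \<and> factor x a b ! i \<noteq> factor y a b ! i}
      (diff_set x y \<inter> {a..b})"
    unfolding bij_betw_def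
  proof
    show "inj_on (\<lambda>i. a + int i)
        {i. i < length (factor x a b) \<and> factor x a b ! i \<noteq> factor y a b ! i}"
      by (auto simp: inj_on_def)
    show "(\<lambda>i. a + int i) `
        {i. i < length (factor x a b) \<and> factor x a b ! i \<noteq> factor y a b ! i} =
        diff_set x y \<inter> {a..b}" (is "?f ` ?A = ?B")
    proof
      show "?f ` ?A \<subseteq> ?B"
        by (auto simp: factor_def diff_set_def nth_upto)
      show "?B \<subseteq> ?f ` ?A"
      proof
        fix i assume "i \<in> ?B"
        then have "nat (i - a) \<in> ?A" "i = ?f (nat (i - a))"
          by (auto simp: factor_def diff_set_def nth_upto)
        then show "i \<in> ?f ` ?A" by blast
      qed
    qed
  qed
  then show ?thesis
    unfolding hamming_def by (rule bij_betw_same_card)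
qed

section \<open>Counting a periodic set in windows\<close>

text \<open>Sliding a window of length \<open>p\<close> by one cell loses \<open>c\<close> and gains
  \<open>c + p\<close>, and periodicity puts both or neither of them in \<open>E\<close>.\<close>

lemma card_periodic_window:
  fixes p a b :: int
  assumes "p > 0" and per: "\<And>i. i + p \<in> E \<longleftrightarrow> i \<in> E"
  shows "card (E \<inter> {a..<a + p}) = card (E \<inter> {b..<b + p})"
proof -
  have step: "card (E \<inter> {c..<c + p}) = card (E \<inter> {c + 1..<c + 1 + p})" for c
  proof -
    have "bij_betw (\<lambda>i. if i = c then c + p else i) (E \<inter> {c..<c + p}) (E \<inter> {c + 1..<c + 1 + p})"
      by (rule bij_betw_byWitness[where f' = "\<lambda>i. if i = c + p then c else i"])
        (use assms in \<open>auto split: if_splits\<close>)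
    then show ?thesis by (rule bij_betw_same_card)
  qed
  have "card (E \<inter> {a..<a + p}) = card (E \<inter> {0..<0 + p})" for a
  proof (induction a rule: int_induct[where k = 0])
    case (step1 i)
    then show ?case using step[of i] by simp
  next
    case (step2 i)
    then show ?case using step[of "i - 1"] by (simp add: algebra_simps)
  qed simp
  then show ?thesis by metis
qed

lemma card_periodic_multiple:
  fixes p a b :: int
  assumes "p > 0" and per: "\<And>i. i + p \<in> E \<longleftrightarrow> i \<in> E"
  shows "card (E \<inter> {a..<a + int k * p}) = k * card (E \<inter> {b..<b + p})"
proof (induction k)
  case (Suc k)
  define q where "q = int k * p"
  have "q \<ge> 0" using assms(1) by (simp add: q_def)
  then have "E \<inter> {a..<a + (q + p)} = (E \<inter> {a..<a + q}) \<union> (E \<inter> {a + q..<a + q + p})"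
    using assms(1) by auto
  also have "card \<dots> = card (E \<inter> {a..<a + q}) + card (E \<inter> {a + q..<a + q + p})"
    by (rule card_Un_disjoint) auto
  also have "\<dots> = Suc k * card (E \<inter> {b..<b + p})"
    using Suc card_periodic_window[OF assms, of "a + q" b] by (simp add: q_def)
  also have "q + p = int (Suc k) * p"
    by (simp add: q_def distrib_right)
  finally show ?case .
qed simp

text \<open>A window of length \<open>L\<close> contains \<open>L div p\<close> full periods and is
  contained in one more. The error \<open>h\<close> depends neither on \<open>L\<close> nor on the
  position \<open>a\<close>; the latter is what the Weyl pseudometric requires.\<close>

lemma card_periodic_bounds:
  fixes p a b :: int
  assumes "p > 0" and per: "\<And>i. i + p \<in> E \<longleftrightarrow> i \<in> E"
  defines "h \<equiv> card (E \<inter> {b..<b + p})"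
  shows "\<bar>real (card (E \<inter> {a..<a + int L})) - real h / real_of_int p * real L\<bar> \<le> real h"
proof -
  define k where "k = nat (int L div p)"
  have k: "int k = int L div p"
    using assms(1) by (simp add: k_def pos_imp_zdiv_nonneg_iff)
  have dm: "int L = int k * p + int L mod p"
    unfolding k by simp
  have lo: "int k * p \<le> int L" and hi: "int L < int (Suc k) * p"
    using dm pos_mod_sign[OF assms(1), of "int L"] pos_mod_bound[OF assms(1), of "int L"]
    by (simp_all add: distrib_right)
  have "card (E \<inter> {a..<a + int k * p}) \<le> card (E \<inter> {a..<a + int L})"
    using lo by (intro card_mono) auto
  then have 1: "k * h \<le> card (E \<inter> {a..<a + int L})"
    unfolding h_def using card_periodic_multiple[OF assms(1) per] by metis
  have "card (E \<inter> {a..<a + int L}) \<le> card (E \<inter> {a..<a + int (Suc k) * p})"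
    using hi by (intro card_mono) auto
  then have 2: "card (E \<inter> {a..<a + int L}) \<le> Suc k * h"
    unfolding h_def using card_periodic_multiple[OF assms(1) per] by metis
  have lo': "real k * real_of_int p \<le> real L"
    using lo by (metis of_int_le_iff of_int_mult of_int_of_nat_eq)
  have hi': "real L \<le> (real k + 1) * real_of_int p"
    using hi by (metis less_imp_le of_int_le_iff of_int_mult of_int_of_nat_eq of_nat_Suc add.commute)
  have p: "real_of_int p > 0" using assms(1) by simp
  have "real h * (real k * real_of_int p) \<le> real h * real L"
    using lo' by (intro mult_left_mono) auto
  then have 3: "real k * real h \<le> real h / real_of_int p * real L"
    using p by (simp add: field_simps)
  have "real h * real L \<le> real h * ((real k + 1) * real_of_int p)"
    using hi' by (intro mult_left_mono) auto
  then have 4: "real h / real_of_int p * real L \<le> real k * real h + real h"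
    using p by (simp add: field_simps)
  have 5: "real k * real h \<le> real (card (E \<inter> {a..<a + int L}))"
    using 1 by (metis of_nat_le_iff of_nat_mult)
  have 6: "real (card (E \<inter> {a..<a + int L})) \<le> real k * real h + real h"
    using 2 by (metis of_nat_le_iff of_nat_mult mult_Suc of_nat_add add.commute)
  show ?thesis using 3 4 5 6 by linarith
qed

section \<open>Both pseudometrics on periodic configurations\<close>

lemma limsup_of_rate:
  fixes u :: "nat \<Rightarrow> real"
  assumes "\<And>n. \<bar>u n - c\<bar> \<le> C / real (2 * n + 1)"
  shows "limsup (\<lambda>n. ereal (u n)) = ereal c"
proof -
  have "(\<lambda>n. C / real (2 * n + 1)) \<longlonglongrightarrow> 0"
    by real_asymp
  then have "(\<lambda>n. u n - c) \<longlonglongrightarrow> 0"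
    by (rule Lim_null_comparison[rotated]) (use assms in auto)
  then have "u \<longlonglongrightarrow> c"
    using LIM_zero_iff by blast
  then show ?thesis
    by (intro lim_imp_Limsup) auto
qed

text \<open>Window densities converge to the density of one period at a rate uniform in the window's
  centre, so a maximum over centres does not alter the limit. The free \<open>b\<close> lets the
  period be counted in any convenient window.\<close>

lemma periodic_distance:
  fixes x y :: "'a config" and p b :: int
  assumes "p > 0" and "\<And>i. x (i + p) = x i" and "\<And>i. y (i + p) = y i"
    and "d_G = besicovitch \<or> d_G = weyl"
  shows "d_G x y = ereal (real (card (diff_set x y \<inter> {b..<b + p})) / real_of_int p)"
proof -
  define h where "h = card (diff_set x y \<inter> {b..<b + p})"
  define dens where "dens m n = real (hamming (factor x (m - int n) (m + int n))
      (factor y (m - int n) (m + int n))) / real (2 * n + 1)" for m n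
  have bound: "\<bar>dens m n - real h / real_of_int p\<bar> \<le> real h / real (2 * n + 1)" for m n
  proof -
    have win: "{m - int n..<m - int n + int (2 * n + 1)} = {m - int n..m + int n}"
      by auto
    have "\<bar>real (card (diff_set x y \<inter> {m - int n..m + int n}))
        - real h / real_of_int p * real (2 * n + 1)\<bar> \<le> real h"
      using card_periodic_bounds[of p "diff_set x y" "m - int n" "2 * n + 1" b] assms(1-3)
      unfolding win h_def[symmetric] by (simp add: diff_set_def)
    then have "\<bar>real (card (diff_set x y \<inter> {m - int n..m + int n}))
        - real h / real_of_int p * real (2 * n + 1)\<bar> / real (2 * n + 1) \<le> real h / real (2 * n + 1)"
      by (rule divide_right_mono) simp
    moreover have "dens m n - real h / real_of_int p =
      (real (card (diff_set x y \<inter> {m - int n..m + int n}))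
        - real h / real_of_int p * real (2 * n + 1)) / real (2 * n + 1)"
      unfolding dens_def hamming_factor diff_divide_distrib by simp
    ultimately show ?thesis by (simp only: abs_divide abs_of_nat)
  qed
  have "besicovitch x y = ereal (real h / real_of_int p)"
    unfolding besicovitch_def
    \<comment> \<open>Besicovitch windows are those centred at \<open>m = 0\<close>.\<close>
    by (rule limsup_of_rate[where C = "real h"]) (use bound[of 0] in \<open>simp only: dens_def diff_0 add_0\<close>)
  moreover have "weyl x y = ereal (real h / real_of_int p)"
    unfolding weyl_def dens_def[symmetric]
  proof (rule limsup_of_rate[where C = "real h"])
    fix n
    have "finite (range (\<lambda>m. dens m n))"
      unfolding dens_def by (rule finite_window_densities)
    \<comment> \<open>The maximum is attained at some centre, where the uniform bound
      applies.\<close>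
    then have "Max (range (\<lambda>m. dens m n)) \<in> range (\<lambda>m. dens m n)"
      by (rule Max_in) simp
    then show "\<bar>Max (range (\<lambda>m. dens m n)) - real h / real_of_int p\<bar> \<le> real h / real (2 * n + 1)"
      using bound by force
  qed
  ultimately show ?thesis
    using assms(4) unfolding h_def by blast
qed

section \<open>Cellular automata: translations and the local rule\<close>

lemma cellular_automaton_translate:
  assumes "cellular_automaton f"
  shows "f (\<lambda>i. x (i + k)) = (\<lambda>i. f x (i + k))"
proof (induction k rule: int_induct[where k = 0])
  case (step1 k)
  have "(\<lambda>i. x (i + (k + 1))) = shift (\<lambda>i. x (i + k))"
    by (simp add: shift_def algebra_simps)
  then have "f (\<lambda>i. x (i + (k + 1))) = shift (f (\<lambda>i. x (i + k)))"
    using assms by (simp add: cellular_automaton_def)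
  then show ?case
    unfolding step1 by (simp add: shift_def algebra_simps)
next
  case (step2 k)
  \<comment> \<open>Downwards, the commutation law is solved for the translate by
    \<open>k - 1\<close>, whose value at \<open>i\<close> is read off from \<open>eq\<close> at
    \<open>i - 1\<close>.\<close>
  have "(\<lambda>i. x (i + k)) = shift (\<lambda>i. x (i + (k - 1)))"
    by (simp add: shift_def algebra_simps)
  then have "f (\<lambda>i. x (i + k)) = shift (f (\<lambda>i. x (i + (k - 1))))"
    using assms by (simp add: cellular_automaton_def)
  then have eq: "f x (j + k) = f (\<lambda>i. x (i + (k - 1))) (j + 1)" for j
    unfolding step2 by (simp add: shift_def fun_eq_iff)
  show ?case
  proof
    fix i
    show "f (\<lambda>i. x (i + (k - 1))) i = f x (i + (k - 1))"
      using eq[of "i - 1"] by (simp add: algebra_simps)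
  qed
qed simp

text \<open>A basic open set of the product constrains only finitely many cells, and these fit into
  a window around 0.\<close>

lemma cylinder_in_open:
  fixes x :: "'a config"
  assumes "openin config_topology U" and "x \<in> U"
  obtains r :: nat where "\<And>z. (\<And>i. \<bar>i\<bar> \<le> int r \<Longrightarrow> z i = x i) \<Longrightarrow> z \<in> U"
proof -
  obtain V where V: "finite {i. V i \<noteq> UNIV}" "x \<in> Pi\<^sub>E UNIV V" "Pi\<^sub>E UNIV V \<subseteq> U"
    using assms unfolding config_topology_def openin_product_topology_alt by auto
  \<comment> \<open>\<open>insert 0\<close> keeps \<open>Max\<close> meaningful when no cell is
    constrained.\<close>
  define r where "r = nat (Max (abs ` insert 0 {i. V i \<noteq> UNIV}))"
  have r: "\<bar>i\<bar> \<le> int r" if "V i \<noteq> UNIV" for i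
  proof -
    have "\<bar>i\<bar> \<le> Max (abs ` insert 0 {i. V i \<noteq> UNIV})"
      using V(1) that by (intro Max_ge) auto
    then show ?thesis unfolding r_def by linarith
  qed
  have "z \<in> U" if "\<And>i. \<bar>i\<bar> \<le> int r \<Longrightarrow> z i = x i" for z
  proof -
    have "z i \<in> V i" for i
      using r[of i] that[of i] V(2) by (cases "V i = UNIV") (auto simp: PiE_iff)
    then show ?thesis using V(3) by auto
  qed
  then show thesis using that by blast
qed

lemma openin_cylinder:
  fixes x :: "'a config"
  assumes "finite I"
  shows "openin config_topology {z. \<forall>i\<in>I. z i = x i}"
proof -
  have "{z. \<forall>i\<in>I. z i = x i} = Pi\<^sub>E UNIV (\<lambda>i. if i \<in> I then {x i} else UNIV)"
    by (auto simp: PiE_iff split: if_splits)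
  also have "openin config_topology \<dots>"
    unfolding config_topology_def
    by (rule product_topology_basis) (use assms in \<open>auto elim: finite_subset[rotated]\<close>)
  finally show ?thesis .
qed

text \<open>Tychonoff's theorem; each factor is compact because the alphabet is finite.\<close>

lemma compact_config_topology: "compact_space (config_topology :: ('a::finite) config topology)"
  unfolding config_topology_def
  by (simp add: compact_space_product_topology compact_space_discrete_topology)

text \<open>One direction of the Curtis-Hedlund-Lyndon theorem: continuity gives a radius for each
  configuration, compactness a common one for cell 0, and translation carries it to every
  cell.\<close>

lemma cellular_automaton_radius:
  fixes f :: "('a::finite) config \<Rightarrow> 'a config"
  assumes ca: "cellular_automaton f"
  obtains r :: nat where
    "\<And>x y j. (\<And>i. \<bar>i - j\<bar> \<le> int r \<Longrightarrow> x i = y i) \<Longrightarrow> f x j = f y j"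
proof -
  have top: "topspace (config_topology :: 'a config topology) = UNIV"
    by (simp add: config_topology_def)
  have "\<exists>r::nat. \<forall>z. (\<forall>i\<in>{-int r..int r}. z i = x i) \<longrightarrow> f z 0 = f x 0" for x
  proof -
    have "continuous_map config_topology config_topology f"
      using ca by (simp add: cellular_automaton_def)
    \<comment> \<open>The configurations whose image has the letter \<open>f x 0\<close> at cell 0
      form an open neighbourhood of \<open>x\<close>, which therefore contains a cylinder.\<close>
    then have "openin config_topology {z \<in> topspace config_topology. f z \<in> {w. \<forall>i\<in>{0}. w i = f x i}}"
      by (rule openin_continuous_map_preimage) (rule openin_cylinder, simp)
    then have "openin config_topology {z. f z 0 = f x 0}"
      by (simp add: top)
    then obtain r :: nat where
      r: "\<And>z. (\<And>i. \<bar>i\<bar> \<le> int r \<Longrightarrow> z i = x i) \<Longrightarrow> z \<in> {z. f z 0 = f x 0}"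
      using cylinder_in_open[of "{z. f z 0 = f x 0}" x] by blast
    have "f z 0 = f x 0" if z: "\<forall>i\<in>{-int r..int r}. z i = x i" for z
    proof -
      have "z \<in> {z. f z 0 = f x 0}"
        by (rule r) (use z in \<open>auto simp: abs_le_iff\<close>)
      then show ?thesis by simp
    qed
    then have "\<forall>z. (\<forall>i\<in>{-int r..int r}. z i = x i) \<longrightarrow> f z 0 = f x 0"
      by blast
    then show ?thesis by (rule exI)
  qed
  then have "\<forall>x. \<exists>r::nat. \<forall>z. (\<forall>i\<in>{-int r..int r}. z i = x i) \<longrightarrow> f z 0 = f x 0"
    by (rule allI)
  from choice[OF this] obtain R :: "'a config \<Rightarrow> nat" where
    R': "\<forall>x z. (\<forall>i\<in>{-int (R x)..int (R x)}. z i = x i) \<longrightarrow> f z 0 = f x 0"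
    by (rule exE)
  have R: "f z 0 = f x 0" if "\<And>i. i \<in> {-int (R x)..int (R x)} \<Longrightarrow> z i = x i" for x z
    using R' that by blast
  define C where "C x = {z. \<forall>i\<in>{-int (R x)..int (R x)}. z i = x i}" for x
  have "\<forall>U\<in>range C. openin config_topology U"
    unfolding C_def by (auto intro!: openin_cylinder)
  moreover have "topspace config_topology \<subseteq> \<Union>(range C)"
    by (auto simp: C_def)
  ultimately obtain \<F> where \<F>: "finite \<F>" "\<F> \<subseteq> range C" "topspace config_topology \<subseteq> \<Union>\<F>"
    using compact_config_topology unfolding compact_space_alt by meson
  then obtain X where X: "finite X" "\<F> = C ` X"
    by (metis finite_subset_image subset_UNIV)
  define r where "r = Max (insert 0 (R ` X))"
  have Rr: "R x \<le> r" if "x \<in> X" for x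
    unfolding r_def using X(1) that by (intro Max_ge) auto
  have zero: "f x 0 = f y 0" if eq: "\<And>i. \<bar>i\<bar> \<le> int r \<Longrightarrow> x i = y i" for x y
  proof -
    \<comment> \<open>If \<open>x\<close> lies in the cylinder of \<open>c\<close>, so does
      \<open>y\<close>, because \<open>R c \<le> r\<close>; both images then have the letter
      \<open>f c 0\<close> at cell 0.\<close>
    obtain c where c: "c \<in> X" "x \<in> C c"
      using \<F>(3) X(2) top by auto
    have xy: "x i = y i" if "i \<in> {-int (R c)..int (R c)}" for i
      using eq[of i] Rr[OF c(1)] that by auto
    have "f x 0 = f c 0"
      by (rule R) (use c(2) in \<open>auto simp: C_def\<close>)
    moreover have "f y 0 = f c 0"
      by (rule R) (use c(2) xy in \<open>auto simp: C_def\<close>)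
    ultimately show ?thesis by simp
  qed
  have "f x j = f y j" if eq: "\<And>i. \<bar>i - j\<bar> \<le> int r \<Longrightarrow> x i = y i" for x y j
  proof -
    have "f (\<lambda>i. x (i + j)) 0 = f (\<lambda>i. y (i + j)) 0"
      by (rule zero) (simp add: eq)
    then show ?thesis
      by (simp add: cellular_automaton_translate[OF ca])
  qed
  then show thesis using that by blast
qed

section \<open>From the isometry to finite difference counts\<close>

text \<open>Finitely many differences are repeated periodically, far enough apart for
  their images not to interact.\<close>

lemma isometry_preserves_card_diff:
  fixes f :: "('a::finite) config \<Rightarrow> 'a config"
  assumes G: "d_G = besicovitch \<or> d_G = weyl"
    and ca: "cellular_automaton f"
    and iso: "\<And>x y. d_G (f x) (f y) = d_G x y"
    and fin: "finite (diff_set x y)"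
  shows "finite (diff_set (f x) (f y)) \<and> card (diff_set (f x) (f y)) = card (diff_set x y)"
proof -
  obtain r :: nat where r: "\<And>x y j. (\<And>i. \<bar>i - j\<bar> \<le> int r \<Longrightarrow> x i = y i) \<Longrightarrow> f x j = f y j"
    using cellular_automaton_radius[OF ca] by blast
  define N where "N = Max (abs ` insert 0 (diff_set x y))"
  have N: "\<bar>i\<bar> \<le> N" if "i \<in> diff_set x y" for i
    unfolding N_def using fin that by (intro Max_ge) auto
  have N0: "0 \<le> N" unfolding N_def using fin by (intro Max_ge) auto
  \<comment> \<open>Image differences stay within \<open>N + r\<close>; the second \<open>r\<close>
    keeps everything the local rule reads there inside the repeated block.\<close>
  define M where "M = N + 2 * int r"
  define p where "p = 2 * M + 1"
  have p: "p > 0" using N0 by (simp add: p_def M_def)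
  \<comment> \<open>The block of \<open>z\<close> on \<open>{- M..M}\<close> is repeated with its
    length \<open>p = 2 * M + 1\<close>.\<close>
  define per :: "'a config \<Rightarrow> 'a config" where "per z = (\<lambda>i. z ((i + M) mod p - M))" for z
  have per_in: "per z i = z i" if "\<bar>i\<bar> \<le> M" for z i
    using that by (simp add: per_def p_def)
  have per_p: "per z (i + p) = per z i" for z i
  proof -
    have "(i + p + M) mod p = (i + M + p) mod p" by (simp add: algebra_simps)
    then show ?thesis by (simp add: per_def)
  qed
  have fper_p: "f (per z) (i + p) = f (per z) i" for z i
    using cellular_automaton_translate[OF ca, of "per z" p] by (simp add: per_p fun_eq_iff)
  have win: "{- M..<- M + p} = {- M..M}" by (auto simp: p_def)
  have near: "diff_set x y \<inter> {- M..M} = diff_set x y"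
    using N by (force simp: M_def)
  have per_diff: "diff_set (per x) (per y) \<inter> {- M..M} = diff_set x y \<inter> {- M..M}"
    using per_in by (auto simp: diff_set_def)
  have out: "x i = y i" if "\<bar>i\<bar> > N" for i
    using N that by (force simp: diff_set_def)
  \<comment> \<open>Up to \<open>r\<close> cells beyond the block no difference of a neighbouring
    copy is met: such a cell reduces modulo \<open>p\<close> to one of absolute value greater than
    \<open>N + r\<close>.\<close>
  have out_per: "per x i = per y i" if "N < \<bar>i\<bar>" "\<bar>i\<bar> \<le> M + int r" for i
  proof -
    consider "\<bar>i\<bar> \<le> M" | "i > M" | "i < - M" by linarith
    then have "N < \<bar>(i + M) mod p - M\<bar>"
    proof cases
      case 1
      then show ?thesis using that by (simp add: p_def)
    next
      case 2
      have "(i + M) mod p = (i + M - p) mod p" by simp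
      also have "\<dots> = i + M - p"
        using 2 that p N0 by (intro mod_pos_pos_trivial) (auto simp: p_def M_def)
      finally show ?thesis using 2 that N0 by (simp add: p_def M_def)
    next
      case 3
      have "(i + M) mod p = (i + M + p) mod p" by simp
      also have "\<dots> = i + M + p"
        using 3 that p N0 by (intro mod_pos_pos_trivial) (auto simp: p_def M_def)
      finally show ?thesis using 3 that N0 by (simp add: p_def M_def)
    qed
    then show ?thesis unfolding per_def by (rule out)
  qed
  have img: "\<bar>j\<bar> \<le> N + int r" if "j \<in> diff_set (f x) (f y)" for j
  proof (rule ccontr)
    assume "\<not> \<bar>j\<bar> \<le> N + int r"
    then have "f x j = f y j" by (intro r out) linarith
    with that show False by (simp add: diff_set_def)
  qed
  have img_per: "diff_set (f (per x)) (f (per y)) \<inter> {- M..M} = diff_set (f x) (f y)"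
  proof (rule set_eqI)
    fix j
    \<comment> \<open>Near 0 the local rule sees only the original block; in the rest of the block
      it sees no difference; beyond the block both sides are empty.\<close>
    consider "\<bar>j\<bar> \<le> N + int r" | "N + int r < \<bar>j\<bar>" "\<bar>j\<bar> \<le> M" | "\<bar>j\<bar> > M" by linarith
    then show "j \<in> diff_set (f (per x)) (f (per y)) \<inter> {- M..M} \<longleftrightarrow> j \<in> diff_set (f x) (f y)"
    proof cases
      case 1
      have "f (per z) j = f z j" for z
        by (intro r per_in) (use 1 in \<open>unfold M_def, linarith\<close>)
      moreover have "j \<in> {- M..M}" using 1 by (auto simp: M_def)
      ultimately show ?thesis by (simp add: diff_set_def)
    next
      case 2
      have "f (per x) j = f (per y) j"
        by (intro r out_per) (use 2 in linarith)+
      then show ?thesis using img[of j] 2 by (auto simp: diff_set_def)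
    next
      case 3
      then show ?thesis using img[of j] by (auto simp: M_def)
    qed
  qed
  \<comment> \<open>Both distances are counts over one block divided by \<open>p\<close>, so the
    isometry equates the counts.\<close>
  have "d_G (f (per x)) (f (per y)) = d_G (per x) (per y)" by (rule iso)
  then have "real (card (diff_set (f x) (f y))) / real_of_int p = real (card (diff_set x y)) / real_of_int p"
    using periodic_distance[of p "per x" "per y" d_G "- M", OF p per_p per_p G]
      periodic_distance[of p "f (per x)" "f (per y)" d_G "- M", OF p fper_p fper_p G]
    unfolding win img_per per_diff near by simp
  then have "card (diff_set (f x) (f y)) = card (diff_set x y)" using p by simp
  moreover have "finite (diff_set (f x) (f y))"
    by (rule finite_subset[of _ "{- M..M}"]) (use img_per in auto)
  ultimately show ?thesis by blast
qed

section \<open>Which image cell a single change affects\<close>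

text \<open>With a one-letter alphabet this holds vacuously for every cell \<open>k\<close>.\<close>

definition moves :: "('a config \<Rightarrow> 'a config) \<Rightarrow> 'a config \<Rightarrow> int \<Rightarrow> int \<Rightarrow> bool" where
  "moves f x i k \<longleftrightarrow> (\<forall>s. s \<noteq> x i \<longrightarrow> diff_set (f x) (f (x(i := s))) = {k})"

text \<open>The combinatorial content of the isometry. As \<open>card\<close> of an infinite set is
  0, it also forces the image differences to be finite.\<close>

definition preserves_card_diff :: "('a config \<Rightarrow> 'a config) \<Rightarrow> bool" where
  "preserves_card_diff f \<longleftrightarrow>
     (\<forall>x y. finite (diff_set x y) \<longrightarrow> card (diff_set (f x) (f y)) = card (diff_set x y))"

lemma diff_set_one_update:
  assumes "s \<noteq> t"
  shows "diff_set (x(i := s)) (x(i := t)) = {i}"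
  using assms by (auto simp: diff_set_def)

lemma diff_set_two_updates:
  assumes "i \<noteq> j" "s \<noteq> x i" "t \<noteq> x j"
  shows "diff_set (x(i := s)) (x(j := t)) = {i, j}" and "diff_set x (x(j := t, i := s)) = {i, j}"
  using assms by (auto simp: diff_set_def)

lemma preserves_one_update:
  assumes "preserves_card_diff f" "s \<noteq> t"
  obtains k where "diff_set (f (x(i := s))) (f (x(i := t))) = {k}"
proof -
  have "card (diff_set (f (x(i := s))) (f (x(i := t)))) = 1"
    using assms diff_set_one_update[OF assms(2), of x i] by (simp add: preserves_card_diff_def)
  then show thesis using that by (rule card_1_singletonE)
qed

lemma preserves_one_update':
  assumes "preserves_card_diff f" "t \<noteq> x i"
  obtains k where "diff_set (f x) (f (x(i := t))) = {k}"
  using preserves_one_update[OF assms(1), of "x i" t x i] assms(2) by auto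

text \<open>If two new letters in cell \<open>i\<close> affected different cells \<open>k\<close>
  and \<open>l\<close>, the two modified configurations, which differ only in \<open>i\<close>,
  would have images differing in both.\<close>

lemma ex_moves:
  assumes f: "preserves_card_diff f"
  shows "\<exists>k. moves f x i k"
proof (cases "\<exists>s. s \<noteq> x i")
  case True
  then obtain s where s: "s \<noteq> x i" by blast
  obtain k where k: "diff_set (f x) (f (x(i := s))) = {k}"
    using preserves_one_update'[OF f, of s x i] s by blast
  have "diff_set (f x) (f (x(i := t))) = {k}" if t: "t \<noteq> x i" for t
  proof (cases "t = s")
    case False
    obtain l where l: "diff_set (f x) (f (x(i := t))) = {l}"
      using preserves_one_update'[OF f, of t x i] t by blast
    obtain q where q: "diff_set (f (x(i := s))) (f (x(i := t))) = {q}"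
      using preserves_one_update[OF f False[symmetric]] by blast
    have "k = l"
    proof (rule ccontr)
      assume "k \<noteq> l"
      then have "k \<in> diff_set (f (x(i := s))) (f (x(i := t)))"
        "l \<in> diff_set (f (x(i := s))) (f (x(i := t)))"
        using k[THEN diff_set_singletonD] l[THEN diff_set_singletonD] \<open>k \<noteq> l\<close>
        by (metis (mono_tags, lifting) diff_set_def mem_Collect_eq)+
      with q \<open>k \<noteq> l\<close> show False by simp
    qed
    with l show ?thesis by simp
  qed (use k in simp)
  then show ?thesis unfolding moves_def by blast
qed (auto simp: moves_def)

text \<open>All images under changes of cell \<open>i\<close> agree with \<open>f x\<close> off
  \<open>k\<close>, so two of them can differ only at \<open>k\<close>.\<close>

lemma moves_update_same:
  assumes f: "preserves_card_diff f" and m: "moves f x i k"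
  shows "moves f (x(i := b)) i k"
  unfolding moves_def
proof (intro allI impI)
  fix s assume "s \<noteq> (x(i := b)) i"
  then have s: "b \<noteq> s" by simp
  obtain q where q: "diff_set (f (x(i := b))) (f (x(i := s))) = {q}"
    using preserves_one_update[OF f s] by blast
  have "f (x(i := t)) j = f x j" if "j \<noteq> k" for t j
    using m that diff_set_singletonD[of "f x" "f (x(i := t))" k j]
    by (cases "t = x i") (simp_all add: moves_def)
  then have "f (x(i := b)) q = f (x(i := s)) q" if "q \<noteq> k"
    using that by simp
  then have "q = k" using diff_set_singletonD[OF q, of q] by blast
  then show "diff_set (f (x(i := b))) (f ((x(i := b))(i := s))) = {k}" using q by simp
qed

lemma moves_update_other:
  assumes f: "preserves_card_diff f" and m: "moves f x i k" and "i \<noteq> j" "b \<noteq> x j"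
  shows "moves f (x(j := b)) i k"
  unfolding moves_def
proof (intro allI impI)
  fix s assume "s \<noteq> (x(j := b)) i"
  then have s: "s \<noteq> x i" using \<open>i \<noteq> j\<close> by simp
  \<comment> \<open>The four corners of a square: \<open>x\<close>, a change in \<open>i\<close>
    (\<open>u\<close>), a change in \<open>j\<close> (\<open>v\<close>), and both
    (\<open>w\<close>).\<close>
  define u where "u = x(i := s)"
  define v where "v = x(j := b)"
  define w where "w = x(j := b, i := s)"
  have w: "w = v(i := s)" "w = u(j := b)"
    using \<open>i \<noteq> j\<close> by (auto simp: u_def v_def w_def)
  have xu: "diff_set (f x) (f u) = {k}"
    using m s by (simp add: moves_def u_def)
  obtain l where xv: "diff_set (f x) (f v) = {l}"
    unfolding v_def using preserves_one_update'[OF f, of b x j] \<open>b \<noteq> x j\<close> by blast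
  obtain k' where vw: "diff_set (f v) (f w) = {k'}"
    unfolding w(1) by (rule preserves_one_update'[OF f, of s v i]) (use s \<open>i \<noteq> j\<close> in \<open>auto simp: v_def\<close>)
  obtain l' where uw: "diff_set (f u) (f w) = {l'}"
    unfolding w(2) by (rule preserves_one_update'[OF f, of b u j]) (use assms(3,4) in \<open>auto simp: u_def\<close>)
  have duv: "card (diff_set (f u) (f v)) = 2" and dxw: "card (diff_set (f x) (f w)) = 2"
    using f diff_set_two_updates[of i j s x b] s assms(3,4)
    by (simp_all add: preserves_card_diff_def u_def v_def w_def)
  \<comment> \<open>Going from \<open>f u\<close> to \<open>f v\<close> through \<open>f x\<close>
    and through \<open>f w\<close> gives two descriptions of the same two-element set.\<close>
  have uv: "diff_set (f u) (f v) \<subseteq> {k, l}"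
    using xu xv by (force simp: diff_set_def set_eq_iff)
  then have "diff_set (f u) (f v) = {k, l}"
    using duv by (intro card_seteq) (auto simp: card_insert_if)
  moreover have "diff_set (f u) (f v) \<subseteq> {k', l'}"
    using vw uw by (force simp: diff_set_def set_eq_iff)
  ultimately have kl: "{k, l} = {k', l'}"
    using duv by (intro card_seteq) (auto simp: card_insert_if)
  \<comment> \<open>Otherwise the path from \<open>f x\<close> through \<open>f v\<close> to
    \<open>f w\<close> changes only cell \<open>l\<close>, although the other diagonal of the square
    also needs two differences.\<close>
  have "k' \<noteq> l"
  proof
    assume "k' = l"
    then have "diff_set (f x) (f w) \<subseteq> {l}"
      using xv vw by (force simp: diff_set_def set_eq_iff)
    then have "card (diff_set (f x) (f w)) \<le> 1"
      using card_mono[of "{l}"] by simp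
    with dxw show False by simp
  qed
  with kl have "k' = k" by auto
  with vw show "diff_set (f (x(j := b))) (f ((x(j := b))(i := s))) = {k}"
    by (simp add: v_def w_def)
qed

lemma moves_update:
  assumes "preserves_card_diff f" "moves f x i k"
  shows "moves f (x(j := b)) i k"
  using assms moves_update_same moves_update_other
  by (cases "i = j"; cases "b = x j") (auto simp: fun_upd_idem)

text \<open>Cells of \<open>A\<close> are overwritten one at a time. Each change affects only
  \<open>j + k\<close>, distinct from \<open>m + k\<close>, and leaves the relation
  \<open>moves\<close> intact for the next change.\<close>

lemma moves_override_on:
  assumes f: "preserves_card_diff f" and "finite A" and "\<And>i. moves f u i (i + k)" and "m \<notin> A"
  shows "(\<forall>i. moves f (override_on u x A) i (i + k)) \<and> f (override_on u x A) (m + k) = f u (m + k)"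
  using assms(2,4)
proof (induction A)
  case empty
  then show ?case using assms(3) by simp
next
  case (insert j A)
  define w where "w = override_on u x A"
  have w: "override_on u x (insert j A) = w(j := x j)"
    by (simp add: w_def override_on_insert)
  have IH: "\<And>i. moves f w i (i + k)" "f w (m + k) = f u (m + k)"
    using insert by (auto simp: w_def)
  have "f (w(j := x j)) (m + k) = f w (m + k)"
  proof (cases "x j = w j")
    case False
    then have "diff_set (f w) (f (w(j := x j))) = {j + k}"
      using IH(1)[of j] by (simp add: moves_def)
    moreover have "m + k \<noteq> j + k" using insert by auto
    ultimately have "m + k \<notin> diff_set (f w) (f (w(j := x j)))" by simp
    then show ?thesis by (simp add: diff_set_def)
  qed (simp add: fun_upd_idem)
  then show ?case
    unfolding w using moves_update[OF f IH(1)] IH(2) by metis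
qed

lemma moves_translate:
  assumes "cellular_automaton f" and "moves f x i k"
  shows "moves f (\<lambda>l. x (l - m)) (i + m) (k + m)"
  unfolding moves_def
proof (intro allI impI)
  fix s assume s: "s \<noteq> x (i + m - m)"
  have upd: "(\<lambda>l. x (l - m))(i + m := s) = (\<lambda>l. (x(i := s)) (l - m))"
    by (simp add: fun_eq_iff)
  have tr: "f (\<lambda>l. z (l - m)) = (\<lambda>l. f z (l - m))" for z
    using cellular_automaton_translate[OF assms(1), of z "- m"] by simp
  have "diff_set (f x) (f (x(i := s))) = {k}"
    using assms(2) s by (simp add: moves_def)
  from diff_set_singletonD[OF this] have iff: "f x j \<noteq> f (x(i := s)) j \<longleftrightarrow> j = k" for j
    by simp
  show "diff_set (f (\<lambda>l. x (l - m))) (f ((\<lambda>l. x (l - m))(i + m := s))) = {k + m}"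
    unfolding upd tr[of x] tr[of "x(i := s)"] diff_set_def iff by auto
qed

section \<open>Reading off the shift and the symbol permutation\<close>

theorem corollary3:
  fixes f :: "('a::finite) config \<Rightarrow> 'a config"
    and d_G :: "'a config \<Rightarrow> 'a config \<Rightarrow> ereal"
  assumes "d_G = besicovitch \<or> d_G = weyl"
    and "cellular_automaton f"
    and "\<And>x y. d_G (f x) (f y) = d_G x y"
  shows "\<exists>(n::int) (g::'a \<Rightarrow> 'a). bij g \<and> (\<forall>x i. f x i = g (x (i + n)))"
proof -
  note ca = assms(2)
  have f: "preserves_card_diff f"
    using isometry_preserves_card_diff[of d_G f, OF assms(1,2) assms(3)]
    by (simp add: preserves_card_diff_def)
  obtain r :: nat where r: "\<And>x y j. (\<And>i. \<bar>i - j\<bar> \<le> int r \<Longrightarrow> x i = y i) \<Longrightarrow> f x j = f y j"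
    using cellular_automaton_radius[OF ca] by blast
  \<comment> \<open>A constant configuration equals all its translates, so one displacement
    \<open>k\<close> found at cell 0 serves every cell. The letter \<open>undefined\<close> is
    arbitrary.\<close>
  define c :: "'a config" where "c = (\<lambda>_. undefined)"
  obtain k where "moves f c 0 k"
    using ex_moves[OF f] by blast
  from moves_translate[OF ca this] have mc: "moves f c i (i + k)" for i
    by (simp add: c_def add.commute)
  define g where "g s = f (c(0 := s)) k" for s
  have "inj g"
  proof (rule injI, rule ccontr)
    fix s t assume "g s = g t" "s \<noteq> t"
    have "moves f (c(0 := s)) 0 (0 + k)"
      by (rule moves_update[OF f mc])
    then have "diff_set (f (c(0 := s))) (f (c(0 := t))) = {k}"
      using \<open>s \<noteq> t\<close> by (simp add: moves_def)
    with \<open>g s = g t\<close> show False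
      by (auto simp: g_def diff_set_def set_eq_iff)
  qed
  \<comment> \<open>On a finite alphabet injectivity suffices.\<close>
  then have "bij g"
    by (simp add: bij_def finite_UNIV_inj_surj)
  moreover have "f x j = g (x (j + - k))" for x j
  proof -
    \<comment> \<open>Cell \<open>m\<close> is the one that moves to \<open>j\<close>, so the shift
      is by \<open>- k\<close>.\<close>
    define m where "m = j - k"
    define u where "u = c(m := x m)"
    \<comment> \<open>\<open>A\<close> holds the cells read for the image at \<open>j\<close>,
      except \<open>m\<close>, where \<open>u\<close> already agrees with \<open>x\<close>.\<close>
    define A where "A = {j - int r..j + int r} - {m}"
    have "f x j = f (override_on u x A) j"
      by (rule r) (auto simp: override_on_def u_def A_def)
    also have "\<dots> = f (override_on u x A) (m + k)"
      by (simp add: m_def)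
    also have "\<dots> = f u (m + k)"
      using moves_override_on[OF f, of A u k m x] moves_update[OF f mc]
      by (simp add: A_def u_def)
    also have "\<dots> = f (\<lambda>i. u (i + m)) k"
      unfolding cellular_automaton_translate[OF ca, of u m] by (simp add: add.commute)
    also have "(\<lambda>i. u (i + m)) = c(0 := x m)"
      by (auto simp: u_def c_def)
    finally show ?thesis by (simp add: g_def m_def fun_upd_def)
  qed
  ultimately show ?thesis by blast
qed

end
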